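(* Let $f\colon T\times X\to\overline{\mathbb{R}}$ be such that the multifunction $t\rightrightarrows \operatorname{epi} f_t$ is lower semicontinuous with closed and convex values. Let $m_f(t):=\inf_{x\in X}f_t(x)$ and suppose that $\mathcal{D}_c(m_f)\neq\emptyset$, i.e. there exists an integrable continuous function $h\colon T\to\mathbb{R}$ with $m_f(t)<h(t)$ for all $t\in T$. Then $$\inf_{\phi\in\mathcal{C}(T,X)}\int_T f_t(\phi(t))\,d\mu=\int_T\inf_{x\in X}f_t(x)\,d\mu=\int_T m_f(t)\,d\mu .$$
   Context: Standing assumptions: $X$ is a (not necessarily separable) Banach space, $(T,d)$ is a metric space, and $(T,\mathcal{A},\mu)$ is a complete $\sigma$-finite measure space with $\mathcal{A}$ containing the Borel $\sigma$-algebra of $T$; $\mu$ is inner regular, meaning that for all $\varepsilon>0$ and $B\in\mathcal{A}$ of finite measure there is a compact $K\subset B$ with $\mu(B\setminus K)<\varepsilon$. Notation: $\overline{\mathbb{R}}=[-\infty,\infty]$; $f_t(x):=f(t,x)$; $\operatorname{epi} f_t:=\{(x,\alpha)\in X\times\mathbb{R}: f_t(x)\le\alpha\}$; $\mathcal{C}(T,X)$ is the set of continuous functions $T\to X$; $\mathcal{D}_c(m_f)$ is the set of all integrable functions $h\in\mathcal{C}(T,\mathbb{R})$ such that $m_f(t)<h(t)$ for all $t\in T$. A multifunction $\Phi$ is lower semicontinuous (lsc) at $t$ if for every open $V$ with $\Phi(t)\cap V\neq\emptyset$ there is a neighbourhood $U$ of $t$ with $\Phi(s)\cap V\neq\emptyset$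 for all $s\in U$; it is lsc if it is lsc at every point where its value is nonempty. Integrals of extended-real-valued measurable functions are upper integrals: $\int_T g\,d\mu:=\int_T\max\{g,0\}\,d\mu+\int_T\min\{g,0\}\,d\mu$ with the convention $+\infty+(-\infty)=+\infty$. *)

theory Defs
  imports "HOL-Analysis.Analysis"
begin

text \<open>The library's \<open>epigraph\<close> is restricted to real-valued functions.\<close>

definition epi :: "('x \<Rightarrow> ereal) \<Rightarrow> ('x \<times> real) set" where
  "epi g = {(x, \<alpha>). g x \<le> ereal \<alpha>}"

definition lsc_multi_at ::
  "('t::topological_space \<Rightarrow> 'y::topological_space set) \<Rightarrow> 't \<Rightarrow> bool" where
  "lsc_multi_at \<Phi> t \<longleftrightarrow>
     (\<forall>V. open V \<and> \<Phi> t \<inter> V \<noteq> {} \<longrightarrow>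
        (\<exists>U. open U \<and> t \<in> U \<and> (\<forall>s\<in>U. \<Phi> s \<inter> V \<noteq> {})))"

definition lsc_multi ::
  "('t::topological_space \<Rightarrow> 'y::topological_space set) \<Rightarrow> bool" where
  "lsc_multi \<Phi> \<longleftrightarrow> (\<forall>t. \<Phi> t \<noteq> {} \<longrightarrow> lsc_multi_at \<Phi> t)"

definition inner_regular_measure :: "'t::topological_space measure \<Rightarrow> bool" where
  "inner_regular_measure M \<longleftrightarrow>
     (\<forall>\<epsilon>::real. \<forall>B. \<epsilon> > 0 \<and> B \<in> sets M \<and> emeasure M B < \<infinity> \<longrightarrow>
        (\<exists>K. compact K \<and> K \<subseteq> B \<and> emeasure M (B - K) < ennreal \<epsilon>))"

text \<open>
  The integral of \<open>min g 0\<close> is minus the Lebesgue integral of the nonnegative function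
  \<open>- min g 0\<close>.  Addition on \<^typ>\<open>ereal\<close> satisfies \<open>\<infinity> + (-\<infinity>) = \<infinity>\<close>, which is exactly the
  convention of the upper integral.  The definition is meant for measurable \<open>g\<close>.
\<close>

definition upper_integral :: "'t measure \<Rightarrow> ('t \<Rightarrow> ereal) \<Rightarrow> ereal" where
  "upper_integral M g =
     enn2ereal (\<integral>\<^sup>+ t. e2ennreal (max (g t) 0) \<partial>M)
     + (- enn2ereal (\<integral>\<^sup>+ t. e2ennreal (- min (g t) 0) \<partial>M))"

definition inf_fun :: "('t \<Rightarrow> 'x \<Rightarrow> ereal) \<Rightarrow> 't \<Rightarrow> ereal" where
  "inf_fun f t = (INF x. f t x)"

definition cont_integrable_above ::
  "'t::topological_space measure \<Rightarrow> ('t \<Rightarrow> ereal) \<Rightarrow> ('t \<Rightarrow> real) set" where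
  "cont_integrable_above M m =
     {h. continuous_on UNIV h \<and> integrable M h \<and> (\<forall>t. m t < ereal (h t))}"

end

theory Submission
  imports Defs
begin

text \<open>
  The infimum of the integrals is at least the integral of the infimum by monotonicity; the
  content is the reverse inequality.  It rests on two facts.

  First, \<open>m = inf_fun f\<close> can be approximated from above by continuous functions with
  convergence of the integrals.  Lower semicontinuity of the epigraphs makes \<open>m\<close> upper
  semicontinuous (\<open>open_inf_fun_less\<close>), and a continuous \<open>h > m\<close> is given.  Lipschitz envelopes
  of \<open>m - h\<close> produce continuous \<open>H 0 \<ge> H 1 \<ge> \<dots>\<close> with \<open>m < H n \<le> h\<close> and \<open>H n\<close> tending to \<open>m\<close>
  pointwise (\<open>usc_strict_approx_from_above\<close>).  Since \<open>h\<close> is integrable, dominated convergence for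
  the positive parts and monotone convergence for the negative parts give convergence of the
  upper integrals, also when the limit is \<open>-\<infinity>\<close> (\<open>upper_integral_decreasing_limit\<close>).

  Second, for every continuous \<open>H\<close> with \<open>m < H\<close> some continuous \<open>\<phi>\<close> satisfies
  \<open>f t (\<phi> t) \<le> H t\<close> for almost every \<open>t\<close>: the strict sublevel sets
  \<open>{x. f t x < H t}\<close> are nonempty, convex and depend lower semicontinuously on \<open>t\<close>, so Michael's
  selection theorem applies to their closures, and the limit stays below \<open>H\<close> because the
  epigraphs are closed (\<open>selection_below_continuous_bound\<close>).

  By inner regularity and \<open>\<sigma>\<close>-finiteness, \<open>T\<close> is a union of countably many compact sets up to
  a null set, so almost every point lies in the closure of a countable set \<open>D\<close>
  (\<open>inner_regular_ae_separable\<close>).  It suffices to have a function that is continuous on all of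
  \<open>T\<close> and selects on \<open>closure D\<close> (\<open>michael_selection_separable\<close>).  By the Lindelof property of
  \<open>closure D\<close>, countable covers suffice, and for these a partition of unity can be written down
  explicitly as a weighted series (\<open>countable_cover_blend\<close>).  The open set \<open>- closure D\<close> is one
  more member of the cover, which is what extends the selection to the whole space.
\<close>

section \<open>Continuous selections on separable closed sets\<close>

text \<open>A partition of unity in disguise.  The weight of \<open>W k\<close> is a
truncated distance to its complement, scaled by \<open>2\<^sup>-\<^sup>k / (1 + norm (v k))\<close>: this makes both the
series of the weights and the series of the weighted vectors converge uniformly.  Infinitely many
vectors may contribute at a point, hence the closure of the convex hull.\<close>

lemma countable_cover_blend:
  fixes W :: "nat \<Rightarrow> 't::metric_space set" and v :: "nat \<Rightarrow> 'x::banach"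
  assumes op: "\<And>k. open (W k)" and cov: "(\<Union>k. W k) = UNIV"
  shows "\<exists>\<psi>. continuous_on UNIV \<psi> \<and> (\<forall>t. \<psi> t \<in> closure (convex hull {v k |k. t \<in> W k}))"
proof -
  \<comment> \<open>The case split is there because \<open>infdist t {} = 0\<close> by convention.\<close>
  define c where "c k t = (if W k = UNIV then 1 else min 1 (infdist t (- W k)))" for k t
  have c_cont: "continuous_on UNIV (c k)" for k
    unfolding c_def by (cases "W k = UNIV") (auto intro!: continuous_intros)
  have c_range: "0 \<le> c k t" "c k t \<le> 1" for k t
    by (auto simp: c_def infdist_nonneg)
  have c_pos: "0 < c k t \<longleftrightarrow> t \<in> W k" for k t
  proof (cases "W k = UNIV")
    case False
    have cl: "closed (- W k)" and ne: "- W k \<noteq> {}" using op False by auto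
    show ?thesis
      using in_closed_iff_infdist_zero[OF cl ne, of t] infdist_nonneg[of t "- W k"] False
      by (auto simp: c_def)
  qed (auto simp: c_def)
  define p where "p k t = (1/2)^k / (1 + norm (v k)) * c k t" for k t
  have q_pos: "0 < (1/2)^k / (1 + norm (v k))" for k
    by (simp add: add_pos_nonneg)
  have p_cont: "continuous_on UNIV (p k)" for k
    unfolding p_def using q_pos[of k] by (intro continuous_intros c_cont)
  have p_nonneg: "0 \<le> p k t" for k t
    unfolding p_def using q_pos[of k] c_range by (intro mult_nonneg_nonneg) auto
  have p_pos: "0 < p k t \<longleftrightarrow> t \<in> W k" for k t
    unfolding p_def using q_pos[of k] c_pos by (simp only: zero_less_mult_iff) auto
  have p_bound: "p k t * (1 + norm (v k)) \<le> (1/2)^k" for k t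
  proof -
    have "p k t * (1 + norm (v k)) = (1/2)^k * c k t"
      unfolding p_def using norm_ge_zero[of "v k"]
      by (simp add: divide_simps add_nonneg_eq_0_iff)
    then show ?thesis using c_range[where k=k and t=t] by (simp add: mult_left_le)
  qed
  have p_le: "p k t \<le> (1/2)^k" and pv_le: "p k t * norm (v k) \<le> (1/2)^k" for k t
    using p_bound[of k t] p_nonneg[of k t] mult_nonneg_nonneg[OF p_nonneg[of k t] norm_ge_zero[of "v k"]]
    unfolding distrib_left mult_1_right by linarith+
  define s where "s t = (\<Sum>k. p k t)" for t
  define u where "u t = (\<Sum>k. p k t *\<^sub>R v k)" for t
  have geo: "summable (\<lambda>k. (1/2::real)^k)" by (rule summable_geometric) simp
  have s_lim: "uniform_limit UNIV (\<lambda>n t. \<Sum>k<n. p k t) s sequentially"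
    unfolding s_def by (rule Weierstrass_m_test[OF _ geo]) (use p_le p_nonneg in auto)
  have u_lim: "uniform_limit UNIV (\<lambda>n t. \<Sum>k<n. p k t *\<^sub>R v k) u sequentially"
    unfolding u_def by (rule Weierstrass_m_test[OF _ geo]) (use pv_le p_nonneg in auto)
  have s_cont: "continuous_on UNIV s"
    by (rule uniform_limit_theorem[OF _ s_lim]) (auto intro!: always_eventually continuous_intros p_cont)
  have u_cont: "continuous_on UNIV u"
    by (rule uniform_limit_theorem[OF _ u_lim]) (auto intro!: always_eventually continuous_intros p_cont)
  have s_pos: "0 < s t" for t
  proof -
    obtain k where "t \<in> W k" using cov by auto
    then have "0 < p k t" using p_pos by blast
    moreover have "summable (\<lambda>k. p k t)"
      by (rule summable_comparison_test'[OF geo, where N=0]) (use p_le p_nonneg in auto)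
    ultimately show ?thesis unfolding s_def using p_nonneg by (intro suminf_pos2) auto
  qed
  have "u t /\<^sub>R s t \<in> closure (convex hull {v k |k. t \<in> W k})" (is "_ \<in> closure ?H") for t
  proof -
    have sl: "(\<lambda>n. \<Sum>k<n. p k t) \<longlonglongrightarrow> s t" and ul: "(\<lambda>n. \<Sum>k<n. p k t *\<^sub>R v k) \<longlonglongrightarrow> u t"
      using tendsto_uniform_limitI[OF s_lim, of t] tendsto_uniform_limitI[OF u_lim, of t] by auto
    have lim: "(\<lambda>n. (\<Sum>k<n. p k t *\<^sub>R v k) /\<^sub>R (\<Sum>k<n. p k t)) \<longlonglongrightarrow> u t /\<^sub>R s t"
      using s_pos[of t] by (intro tendsto_intros sl ul) auto
    have "\<forall>\<^sub>F n in sequentially. 0 < (\<Sum>k<n. p k t)"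
      using order_tendstoD(1)[OF sl s_pos] .
    then have "\<forall>\<^sub>F n in sequentially. (\<Sum>k<n. p k t *\<^sub>R v k) /\<^sub>R (\<Sum>k<n. p k t) \<in> closure ?H"
    proof eventually_elim
      case (elim n)
      \<comment> \<open>The partial sums, normalised by the partial weights, are finite convex combinations.\<close>
      let ?I = "{k. k < n \<and> t \<in> W k}" and ?s = "\<Sum>k<n. p k t"
      have z: "p k t = 0" if "t \<notin> W k" for k
        using that p_pos[of k t] p_nonneg[of k t] by auto
      have 1: "(\<Sum>k<n. p k t *\<^sub>R v k) = (\<Sum>k\<in>?I. p k t *\<^sub>R v k)"
        by (rule sum.mono_neutral_right) (auto simp: z)
      have 2: "?s = (\<Sum>k\<in>?I. p k t)"
        by (rule sum.mono_neutral_right) (auto simp: z)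
      have "(\<Sum>k\<in>?I. (p k t / ?s) *\<^sub>R v k) \<in> convex hull {v k |k. t \<in> W k}"
      proof (rule convex_sum)
        show "(\<Sum>k\<in>?I. p k t / ?s) = 1"
          using elim 2 by (simp add: sum_divide_distrib[symmetric])
      qed (use elim p_nonneg in \<open>auto intro!: hull_inc\<close>)
      also have "(\<Sum>k\<in>?I. (p k t / ?s) *\<^sub>R v k) = (\<Sum>k<n. p k t *\<^sub>R v k) /\<^sub>R ?s"
        unfolding 1 by (simp add: scaleR_sum_right divide_inverse mult.commute)
      finally show ?case using closure_subset by blast
    qed
    then show ?thesis
      by (rule Lim_in_closed_set[OF closed_closure _ _ lim]) simp
  qed
  moreover have "continuous_on UNIV (\<lambda>t. u t /\<^sub>R s t)"
    using s_pos by (intro continuous_intros s_cont u_cont) (metis less_irrefl)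
  ultimately show ?thesis by blast
qed

text \<open>The balls with centre in \<open>D\<close> and radius
\<open>1 / (n + 1)\<close> form a countable family; those that fit into some \<open>U q\<close> already cover \<open>S\<close>, and
one \<open>q\<close> for each of them is enough.\<close>

lemma separable_subset_Lindelof:
  fixes S :: "'t::metric_space set"
  assumes D: "countable D" "S \<subseteq> closure D"
    and U: "\<And>t. t \<in> S \<Longrightarrow> open (U t)" "\<And>t. t \<in> S \<Longrightarrow> t \<in> U t"
  obtains Q where "countable Q" "Q \<subseteq> S" "S \<subseteq> (\<Union>t\<in>Q. U t)"
proof -
  define P where "P = {(d, n). d \<in> D \<and> (\<exists>q\<in>S. ball d (1 / real (Suc n)) \<subseteq> U q)}"
  define g where "g = (\<lambda>(d, n::nat). SOME q. q \<in> S \<and> ball d (1 / real (Suc n)) \<subseteq> U q)"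
  have "P \<subseteq> D \<times> UNIV" unfolding P_def by auto
  then have P: "countable P" using D(1) by (meson countable_SIGMA countable_subset countableI_type)
  have g: "g (d, n) \<in> S \<and> ball d (1 / real (Suc n)) \<subseteq> U (g (d, n))" if "(d, n) \<in> P" for d n
    using that unfolding P_def g_def by (auto intro: someI2_ex)
  have "S \<subseteq> (\<Union>t\<in>g ` P. U t)"
  proof
    fix t assume t: "t \<in> S"
    obtain r where r: "r > 0" "ball t r \<subseteq> U t" using U t open_contains_ball by meson
    obtain n where n: "1 / real (Suc n) < r / 2" using r(1) nat_approx_posE[of "r/2"] by auto
    obtain d where d: "d \<in> D" "dist d t < 1 / real (Suc n)"
      using D(2) t by (metis closure_approachable subsetD of_nat_0_less_iff zero_less_Suc zero_less_divide_1_iff)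
    have "ball d (1 / real (Suc n)) \<subseteq> ball t r"
    proof
      fix x assume "x \<in> ball d (1 / real (Suc n))"
      then show "x \<in> ball t r"
        using d n dist_triangle[of t x d] by (auto simp: dist_commute)
    qed
    then have "(d, n) \<in> P" using d r t unfolding P_def by auto
    moreover from this have "t \<in> U (g (d, n))" using g[of d n] d by auto
    ultimately show "t \<in> (\<Union>t\<in>g ` P. U t)" by blast
  qed
  moreover have "g ` P \<subseteq> S" using g by auto
  moreover have "countable (g ` P)" using P by simp
  ultimately show thesis using that by blast
qed

text \<open>The approximate form of Michael's theorem.  Near a point \<open>q\<close> every value of \<open>\<Phi>\<close> comes within
\<open>\<epsilon>/2\<close> of one fixed vector \<open>v q\<close>; blending these vectors stays near \<open>\<Phi> t\<close> because the
neighbourhoods of a convex set are convex.  The last conclusion bounds \<open>\<psi>\<close> on the whole space, where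
\<open>0\<close> enters as the vector attached to \<open>- closure D\<close>; it keeps the later corrections small even at
points where nothing is selected.\<close>

lemma approximate_selection:
  fixes \<Phi> :: "'t::metric_space \<Rightarrow> 'x::banach set"
  assumes D: "countable D"
    and ne: "\<And>t. t \<in> closure D \<Longrightarrow> \<Phi> t \<noteq> {}"
    and cvx: "\<And>t. t \<in> closure D \<Longrightarrow> convex (\<Phi> t)"
    and lsc: "\<And>t. t \<in> closure D \<Longrightarrow> lsc_multi_at \<Phi> t"
    and eps: "\<epsilon> > 0"
  obtains \<psi> where "continuous_on UNIV \<psi>"
    and "\<And>t. t \<in> closure D \<Longrightarrow> \<Phi> t \<inter> ball (\<psi> t) \<epsilon> \<noteq> {}"
    and "\<And>t. \<psi> t \<in> closure (convex hull (insert 0 (\<Union>s\<in>closure D. \<Phi> s)))"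
proof -
  define v where "v t = (SOME y. y \<in> \<Phi> t)" for t
  have v: "v t \<in> \<Phi> t" if "t \<in> closure D" for t
    unfolding v_def using ne[OF that] by (simp add: some_in_eq)
  have "\<exists>U. open U \<and> t \<in> U \<and> (\<forall>s\<in>U. \<Phi> s \<inter> ball (v t) (\<epsilon>/2) \<noteq> {})" if "t \<in> closure D" for t
  proof -
    have "v t \<in> \<Phi> t \<inter> ball (v t) (\<epsilon>/2)" using v[OF that] eps by simp
    then have "\<Phi> t \<inter> ball (v t) (\<epsilon>/2) \<noteq> {}" by blast
    then show ?thesis using lsc[OF that] unfolding lsc_multi_at_def by simp
  qed
  then obtain U where U: "\<And>t. t \<in> closure D \<Longrightarrow> open (U t)" "\<And>t. t \<in> closure D \<Longrightarrow> t \<in> U t"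
      "\<And>t s. t \<in> closure D \<Longrightarrow> s \<in> U t \<Longrightarrow> \<Phi> s \<inter> ball (v t) (\<epsilon>/2) \<noteq> {}"
    by metis
  obtain Q where Q: "countable Q" "Q \<subseteq> closure D" "closure D \<subseteq> (\<Union>t\<in>Q. U t)"
    using separable_subset_Lindelof[OF D order_refl U(1,2)] by blast
  define P where "P = insert (- closure D, 0) ((\<lambda>q. (U q, v q)) ` Q)"
  define W where "W k = fst (from_nat_into P k)" for k
  define y where "y k = snd (from_nat_into P k)" for k
  have P: "range (from_nat_into P) = P"
    using Q(1) by (intro range_from_nat_into) (auto simp: P_def)
  have Wy: "(W k, y k) \<in> P" for k unfolding W_def y_def using P by (metis prod.collapse rangeI)
  have opW: "open (W k)" for k
    using Wy[of k] U(1) Q(2) by (auto simp: P_def open_Compl)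
  have covW: "(\<Union>k. W k) = UNIV"
  proof -
    have "(\<Union>k. W k) = (\<Union>z\<in>range (from_nat_into P). fst z)" unfolding W_def by auto
    also have "\<dots> = - closure D \<union> (\<Union>q\<in>Q. U q)" unfolding P by (auto simp: P_def)
    finally show ?thesis using Q(3) by auto
  qed
  obtain \<psi> where \<psi>: "continuous_on UNIV \<psi>" "\<And>t. \<psi> t \<in> closure (convex hull {y k |k. t \<in> W k})"
    using countable_cover_blend[of W y, OF opW covW] by blast
  show thesis
  proof (rule that[OF \<psi>(1)])
    fix t assume t: "t \<in> closure D"
    \<comment> \<open>The open \<open>\<epsilon>/2\<close>-neighbourhood of \<open>\<Phi> t\<close>; the other half of \<open>\<epsilon>\<close> pays for the closure.\<close>
    define E where "E = {x. \<exists>z\<in>\<Phi> t. dist x z < \<epsilon>/2}"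
    have "convex E"
    proof (rule convexI)
      fix a b :: 'x and \<mu> \<kappa> :: real
      assume "a \<in> E" "b \<in> E" and lk: "0 \<le> \<mu>" "0 \<le> \<kappa>" "\<mu> + \<kappa> = 1"
      then obtain a' b' where *: "a' \<in> \<Phi> t" "b' \<in> \<Phi> t" "dist a a' < \<epsilon>/2" "dist b b' < \<epsilon>/2"
        unfolding E_def by blast
      have "(\<mu> *\<^sub>R a + \<kappa> *\<^sub>R b) - (\<mu> *\<^sub>R a' + \<kappa> *\<^sub>R b') \<in> ball 0 (\<epsilon>/2)"
      proof -
        have "\<mu> *\<^sub>R (a - a') + \<kappa> *\<^sub>R (b - b') \<in> ball 0 (\<epsilon>/2)"
          by (rule convexD[OF convex_ball _ _ lk]) (use * in \<open>auto simp: dist_norm norm_minus_commute\<close>)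
        then show ?thesis by (simp add: algebra_simps)
      qed
      then have "dist (\<mu> *\<^sub>R a + \<kappa> *\<^sub>R b) (\<mu> *\<^sub>R a' + \<kappa> *\<^sub>R b') < \<epsilon>/2"
        by (simp only: mem_ball_0 dist_norm)
      moreover have "\<mu> *\<^sub>R a' + \<kappa> *\<^sub>R b' \<in> \<Phi> t" using cvx[OF t] * lk by (simp add: convexD)
      ultimately show "\<mu> *\<^sub>R a + \<kappa> *\<^sub>R b \<in> E" unfolding E_def by blast
    qed
    moreover have "{y k |k. t \<in> W k} \<subseteq> E"
    proof clarify
      fix k assume "t \<in> W k"
      then obtain q where q: "q \<in> Q" "y k = v q" "t \<in> U q" using Wy[of k] t by (auto simp: P_def)
      obtain z where "z \<in> \<Phi> t" "z \<in> ball (v q) (\<epsilon>/2)" using U(3)[of q t] q Q(2) by blast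
      then show "y k \<in> E" unfolding E_def q(2) by auto
    qed
    ultimately have "convex hull {y k |k. t \<in> W k} \<subseteq> E" by (simp add: hull_minimal)
    then have "\<psi> t \<in> closure E" using \<psi>(2)[of t] closure_mono by blast
    then obtain x where "x \<in> E" "dist x (\<psi> t) < \<epsilon>/2"
      using eps by (meson closure_approachable half_gt_zero)
    then obtain z where z: "z \<in> \<Phi> t" "dist x z < \<epsilon>/2" "dist x (\<psi> t) < \<epsilon>/2" unfolding E_def by blast
    then have "dist (\<psi> t) z < \<epsilon>"
      using dist_triangle[of "\<psi> t" z x] by (simp add: dist_commute)
    then show "\<Phi> t \<inter> ball (\<psi> t) \<epsilon> \<noteq> {}" using z(1) by auto
  next
    fix t
    have "{y k |k. t \<in> W k} \<subseteq> insert 0 (\<Union>s\<in>closure D. \<Phi> s)"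
      using Wy v Q(2) unfolding P_def by fastforce
    then show "\<psi> t \<in> closure (convex hull (insert 0 (\<Union>s\<in>closure D. \<Phi> s)))"
      using \<psi>(2)[of t] by (meson closure_mono hull_mono subsetD)
  qed
qed

text \<open>The admissible corrections of \<open>\<phi>\<close> of size less than \<open>\<rho>\<close> depend lower semicontinuously on the
point.  The ball has to be open: lower semicontinuity may be lost by intersecting with a closed set.\<close>

lemma lsc_multi_at_translate_ball:
  fixes \<Phi> :: "'t::metric_space \<Rightarrow> 'x::real_normed_vector set"
  assumes lsc: "lsc_multi_at \<Phi> t" and \<phi>: "continuous_on UNIV \<phi>"
  shows "lsc_multi_at (\<lambda>s. {z \<in> ball 0 \<rho>. \<phi> s + z \<in> \<Phi> s}) t"
  unfolding lsc_multi_at_def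
proof (intro allI impI)
  fix V assume V: "open V \<and> {z \<in> ball 0 \<rho>. \<phi> t + z \<in> \<Phi> t} \<inter> V \<noteq> {}"
  then obtain z where z: "z \<in> ball 0 \<rho> \<inter> V" "\<phi> t + z \<in> \<Phi> t" by blast
  have "open (ball 0 \<rho> \<inter> V)" using V by auto
  then obtain \<delta> where \<delta>: "\<delta> > 0" "ball z \<delta> \<subseteq> ball 0 \<rho> \<inter> V" using z(1) open_contains_ball by meson
  have "\<Phi> t \<inter> ball (\<phi> t + z) (\<delta>/2) \<noteq> {}" using z(2) \<delta>(1) by (metis IntI centre_in_ball empty_iff half_gt_zero)
  then obtain U where U: "open U" "t \<in> U" "\<And>s. s \<in> U \<Longrightarrow> \<Phi> s \<inter> ball (\<phi> t + z) (\<delta>/2) \<noteq> {}"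
    using lsc unfolding lsc_multi_at_def by (meson open_ball)
  define U' where "U' = U \<inter> \<phi> -` ball (\<phi> t) (\<delta>/2)"
  have "open U'" unfolding U'_def using U(1) \<phi> by (intro open_Int open_vimage) auto
  moreover have "t \<in> U'" using U(2) \<delta>(1) by (auto simp: U'_def)
  moreover have "{z \<in> ball 0 \<rho>. \<phi> s + z \<in> \<Phi> s} \<inter> V \<noteq> {}" if s: "s \<in> U'" for s
  proof -
    obtain y where y: "y \<in> \<Phi> s" "dist (\<phi> t + z) y < \<delta>/2" using U(3)[of s] s by (auto simp: U'_def)
    have "z - (y - \<phi> s) = ((\<phi> t + z) - y) - (\<phi> t - \<phi> s)" by simp
    then have "dist z (y - \<phi> s) \<le> dist (\<phi> t + z) y + dist (\<phi> t) (\<phi> s)"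
      unfolding dist_norm by (metis norm_triangle_ineq4)
    also have "\<dots> < \<delta>" using y(2) s by (auto simp: U'_def)
    finally have "y - \<phi> s \<in> ball z \<delta>" by simp
    then have "y - \<phi> s \<in> ball 0 \<rho> \<inter> V" using \<delta>(2) by blast
    then show ?thesis using y(1) by auto
  qed
  ultimately show "\<exists>U. open U \<and> t \<in> U \<and> (\<forall>s\<in>U. {z \<in> ball 0 \<rho>. \<phi> s + z \<in> \<Phi> s} \<inter> V \<noteq> {})" by blast
qed

text \<open>One step of the successive approximation: an approximate selection of the admissible corrections
of \<open>\<phi>\<close> is added to \<open>\<phi>\<close>.\<close>

lemma refine_selection:
  fixes \<Phi> :: "'t::metric_space \<Rightarrow> 'x::banach set"
  assumes D: "countable D"
    and cvx: "\<And>t. t \<in> closure D \<Longrightarrow> convex (\<Phi> t)"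
    and lsc: "\<And>t. t \<in> closure D \<Longrightarrow> lsc_multi_at \<Phi> t"
    and \<phi>: "continuous_on UNIV \<phi>" "\<And>t. t \<in> closure D \<Longrightarrow> \<Phi> t \<inter> ball (\<phi> t) \<rho> \<noteq> {}"
    and pos: "\<rho> > 0" "\<epsilon> > 0"
  obtains \<phi>' where "continuous_on UNIV \<phi>'"
    and "\<And>t. t \<in> closure D \<Longrightarrow> \<Phi> t \<inter> ball (\<phi>' t) \<epsilon> \<noteq> {}" and "\<And>t. dist (\<phi> t) (\<phi>' t) \<le> \<rho>"
proof -
  let ?\<Psi> = "\<lambda>s. {z \<in> ball 0 \<rho>. \<phi> s + z \<in> \<Phi> s}"
  have ne: "?\<Psi> t \<noteq> {}" if t: "t \<in> closure D" for t
  proof -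
    obtain y where "y \<in> \<Phi> t" "dist (\<phi> t) y < \<rho>" using \<phi>(2)[OF t] by auto
    then have "y - \<phi> t \<in> ?\<Psi> t" by (simp add: dist_norm norm_minus_commute)
    then show ?thesis by blast
  qed
  have cvx': "convex (?\<Psi> t)" if t: "t \<in> closure D" for t
  proof -
    have "?\<Psi> t = ball 0 \<rho> \<inter> (\<lambda>y. - \<phi> t + y) ` \<Phi> t"
      by (auto simp: image_iff intro!: bexI[of _ "\<phi> t + _"])
    then show ?thesis using cvx[OF t] by (simp only: convex_Int convex_ball convex_translation)
  qed
  obtain \<psi> where \<psi>: "continuous_on UNIV \<psi>" "\<And>t. t \<in> closure D \<Longrightarrow> ?\<Psi> t \<inter> ball (\<psi> t) \<epsilon> \<noteq> {}"
      "\<And>t. \<psi> t \<in> closure (convex hull (insert 0 (\<Union>s\<in>closure D. ?\<Psi> s)))"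
    using approximate_selection[OF D ne cvx' lsc_multi_at_translate_ball[OF lsc \<phi>(1)] pos(2)] by blast
  show thesis
  proof (rule that)
    show "continuous_on UNIV (\<lambda>t. \<phi> t + \<psi> t)" by (intro continuous_intros \<phi> \<psi>)
  next
    fix t assume "t \<in> closure D"
    then obtain z where z: "\<phi> t + z \<in> \<Phi> t" "dist (\<psi> t) z < \<epsilon>" using \<psi>(2) by fastforce
    then have "\<phi> t + z \<in> \<Phi> t \<inter> ball (\<phi> t + \<psi> t) \<epsilon>" by (simp add: dist_norm)
    then show "\<Phi> t \<inter> ball (\<phi> t + \<psi> t) \<epsilon> \<noteq> {}" by blast
  next
    fix t
    have "insert 0 (\<Union>s\<in>closure D. ?\<Psi> s) \<subseteq> cball 0 \<rho>" using pos by auto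
    then have "convex hull (insert 0 (\<Union>s\<in>closure D. ?\<Psi> s)) \<subseteq> cball 0 \<rho>" by (simp add: hull_minimal)
    then have "closure (convex hull (insert 0 (\<Union>s\<in>closure D. ?\<Psi> s))) \<subseteq> cball 0 \<rho>"
      by (simp only: closure_minimal closed_cball)
    then have "\<psi> t \<in> cball 0 \<rho>" using \<psi>(3)[of t] by blast
    then show "dist (\<phi> t) (\<phi> t + \<psi> t) \<le> \<rho>" by (simp add: dist_norm)
  qed
qed

text \<open>Refining with errors \<open>2\<^sup>-\<^sup>n\<close> moves the function by at most \<open>2\<^sup>-\<^sup>n\<close> at each step, everywhere on the
space, so the approximate selections converge uniformly to a continuous function.  Its distance to \<open>\<Phi> t\<close>
is \<open>0\<close>, which places it in the closure.\<close>

lemma michael_selection_separable: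
  fixes \<Phi> :: "'t::metric_space \<Rightarrow> 'x::banach set"
  assumes D: "countable D"
    and ne: "\<And>t. t \<in> closure D \<Longrightarrow> \<Phi> t \<noteq> {}"
    and cvx: "\<And>t. t \<in> closure D \<Longrightarrow> convex (\<Phi> t)"
    and lsc: "\<And>t. t \<in> closure D \<Longrightarrow> lsc_multi_at \<Phi> t"
  obtains \<phi> where "continuous_on UNIV \<phi>" "\<And>t. t \<in> closure D \<Longrightarrow> \<phi> t \<in> closure (\<Phi> t)"
proof -
  let ?r = "\<lambda>n. (1/2::real)^n"
  let ?P = "\<lambda>n \<phi>. continuous_on UNIV \<phi> \<and> (\<forall>t\<in>closure D. \<Phi> t \<inter> ball (\<phi> t) (?r n) \<noteq> {})"
  have "\<exists>F. \<forall>n. ?P n (F n) \<and> (\<forall>t. dist (F n t) (F (Suc n) t) \<le> ?r n)"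
  proof (rule dependent_nat_choice)
    show "\<exists>\<phi>. ?P 0 \<phi>"
      using approximate_selection[OF D ne cvx lsc, of 1] by (metis power_0 zero_less_one)
  next
    fix \<phi> n assume *: "?P n \<phi>"
    obtain \<phi>' where "continuous_on UNIV \<phi>'" "\<And>t. t \<in> closure D \<Longrightarrow> \<Phi> t \<inter> ball (\<phi>' t) (?r (Suc n)) \<noteq> {}"
      "\<And>t. dist (\<phi> t) (\<phi>' t) \<le> ?r n"
      using refine_selection[OF D cvx lsc, of \<phi> "?r n" "?r (Suc n)"] * by auto
    then show "\<exists>\<phi>'. ?P (Suc n) \<phi>' \<and> (\<forall>t. dist (\<phi> t) (\<phi>' t) \<le> ?r n)" by blast
  qed
  then obtain F where F: "\<And>n. continuous_on UNIV (F n)"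
      "\<And>n t. t \<in> closure D \<Longrightarrow> \<Phi> t \<inter> ball (F n t) (?r n) \<noteq> {}"
      "\<And>n t. dist (F n t) (F (Suc n) t) \<le> ?r n" by auto
  define G where "G t = (\<Sum>k. F (Suc k) t - F k t)" for t
  have "uniform_limit UNIV (\<lambda>n t. \<Sum>k<n. F (Suc k) t - F k t) G sequentially"
    unfolding G_def
    by (rule Weierstrass_m_test[OF _ summable_geometric[of "1/2::real"]])
      (use F(3) in \<open>auto simp: dist_norm norm_minus_commute\<close>)
  then have "uniform_limit UNIV (\<lambda>n t. F 0 t + (\<Sum>k<n. F (Suc k) t - F k t)) (\<lambda>t. F 0 t + G t) sequentially"
    by (intro uniform_limit_intros)
  moreover have "(\<lambda>n t. F 0 t + (\<Sum>k<n. F (Suc k) t - F k t)) = F"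
    by (intro ext) (simp add: sum_lessThan_telescope[of "\<lambda>k. F k _"])
  ultimately have lim: "uniform_limit UNIV F (\<lambda>t. F 0 t + G t) sequentially" by simp
  show thesis
  proof (rule that)
    show "continuous_on UNIV (\<lambda>t. F 0 t + G t)"
      by (rule uniform_limit_theorem[OF _ lim]) (simp_all add: F(1))
  next
    fix t assume t: "t \<in> closure D"
    obtain y where y: "\<And>n. y n \<in> \<Phi> t" "\<And>n. dist (F n t) (y n) < ?r n"
      using F(2)[OF t] by (auto simp: disjoint_iff) metis
    have "(\<lambda>n. norm (F n t - y n)) \<longlonglongrightarrow> 0"
      by (rule tendsto_sandwich[OF _ _ tendsto_const LIMSEQ_power_zero[of "1/2::real"]])
        (use y(2) in \<open>auto simp: dist_norm intro: always_eventually less_imp_le\<close>)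
    then have "(\<lambda>n. F n t - y n) \<longlonglongrightarrow> 0" by (rule tendsto_norm_zero_cancel)
    moreover have "(\<lambda>n. F n t) \<longlonglongrightarrow> F 0 t + G t" using tendsto_uniform_limitI[OF lim] by simp
    ultimately have "y \<longlonglongrightarrow> F 0 t + G t" by (metis Lim_transform2)
    then show "F 0 t + G t \<in> closure (\<Phi> t)" using y(1) unfolding closure_sequential by blast
  qed
qed

section \<open>A separable set of full measure\<close>

lemma compact_imp_subset_closure_countable:
  fixes K :: "'t::metric_space set"
  assumes "compact K"
  obtains D where "countable D" "K \<subseteq> closure D"
proof -
  have "\<exists>k. finite k \<and> K \<subseteq> (\<Union>x\<in>k. ball x (1 / real (Suc n)))" for n
    using assms unfolding compact_eq_totally_bounded by (meson of_nat_0_less_iff zero_less_Suc zero_less_divide_1_iff)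
  then obtain k where k: "\<And>n. finite (k n)" "\<And>n. K \<subseteq> (\<Union>x\<in>k n. ball x (1 / real (Suc n)))"
    by metis
  have "K \<subseteq> closure (\<Union>n. k n)"
    unfolding closure_approachable
  proof (clarsimp simp: closure_approachable)
    fix x and e :: real assume x: "x \<in> K" and "0 < e"
    then obtain n where n: "1 / real (Suc n) < e" using nat_approx_posE by metis
    obtain y where "y \<in> k n" "dist y x < 1 / real (Suc n)" using k(2)[of n] x by auto
    then show "\<exists>n. \<exists>y\<in>k n. dist y x < e" using n by (meson less_trans)
  qed
  moreover have "countable (\<Union>n. k n)" using k(1) by (auto intro: countable_finite)
  ultimately show thesis using that by blast
qed

text \<open>
Each member of a countable cover by sets of finite measure is exhausted by compact sets up to
errors \<open>1 / (n + 1)\<close>; a compact set is totally bounded, hence separable.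
\<close>

lemma inner_regular_ae_separable:
  fixes M :: "'t::metric_space measure"
  assumes "space M = UNIV" "sigma_finite_measure M" "sets borel \<subseteq> sets M" "inner_regular_measure M"
  obtains D where "countable D" "AE t in M. t \<in> closure D"
proof -
  interpret sigma_finite_measure M by fact
  obtain A :: "nat \<Rightarrow> 't set" where A: "range A \<subseteq> sets M" "(\<Union>i. A i) = space M" "\<And>i. emeasure M (A i) \<noteq> \<infinity>"
    using sigma_finite by blast
  have "\<exists>K. compact K \<and> K \<subseteq> A i \<and> emeasure M (A i - K) < ennreal (1 / real (Suc n))" for i n
    using assms(4) A(1,3) unfolding inner_regular_measure_def
    by (auto simp: top.not_eq_extremum)
  then obtain K where K: "\<And>i n. compact (K i n)" "\<And>i n. K i n \<subseteq> A i"
      "\<And>i n. emeasure M (A i - K i n) < ennreal (1 / real (Suc n))" by metis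
  have Kset: "K i n \<in> sets M" for i n
    using K(1) assms(3) by (meson borel_compact subsetD)
  obtain D' where D': "\<And>i n. countable (D' i n)" "\<And>i n. K i n \<subseteq> closure (D' i n)"
  proof -
    have "\<exists>D. countable D \<and> K i n \<subseteq> closure D" for i n
      using compact_imp_subset_closure_countable[OF K(1)] by metis
    then show thesis using that by metis
  qed
  define D where "D = (\<Union>i n. D' i n)"
  have sub: "K i n \<subseteq> closure D" for i n
  proof -
    have "D' i n \<subseteq> D" unfolding D_def by blast
    then show ?thesis using D'(2)[of i n] closure_mono by blast
  qed
  have null: "A i - (\<Union>n. K i n) \<in> null_sets M" for i
  proof -
    have set: "A i - (\<Union>n. K i n) \<in> sets M" using A(1) Kset by auto
    have "emeasure M (A i - (\<Union>n. K i n)) \<le> ennreal e" if e: "e > 0" for e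
    proof -
      obtain n where n: "1 / real (Suc n) < e" using e nat_approx_posE by metis
      have "emeasure M (A i - (\<Union>n. K i n)) \<le> emeasure M (A i - K i n)"
        using A(1) Kset by (intro emeasure_mono) auto
      also have "\<dots> \<le> ennreal (1 / real (Suc n))" using K(3) by (simp add: less_imp_le)
      also have "\<dots> \<le> ennreal e" using n by (intro ennreal_leI) simp
      finally show ?thesis .
    qed
    then have "emeasure M (A i - (\<Union>n. K i n)) \<le> 0"
      by - (rule ennreal_le_epsilon, simp)
    then show ?thesis using set by (simp only: null_sets_def le_zero_eq mem_Collect_eq)
  qed
  have "(\<Union>i. A i - (\<Union>n. K i n)) \<in> null_sets M" using null by blast
  moreover have "{t \<in> space M. t \<notin> closure D} \<subseteq> (\<Union>i. A i - (\<Union>n. K i n))"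
  proof
    fix t assume t: "t \<in> {t \<in> space M. t \<notin> closure D}"
    then obtain i where "t \<in> A i" using A(2) by blast
    moreover have "t \<notin> K i n" for n using sub[of i n] t by blast
    ultimately show "t \<in> (\<Union>i. A i - (\<Union>n. K i n))" by blast
  qed
  ultimately have "AE t in M. t \<in> closure D" by (rule AE_I')
  moreover have "countable D" unfolding D_def using D'(1) by auto
  ultimately show thesis using that by blast
qed

section \<open>Strict sublevel sets of the integrand\<close>

text \<open>If \<open>g t x < \<alpha> < \<beta> < h t\<close>, then \<open>(x, \<alpha>)\<close> is a point of the epigraph in the open set \<open>V \<times> {..<\<beta>}\<close>.
Nearby epigraphs meet the same set, and nearby values of \<open>h\<close> still exceed \<open>\<beta>\<close>.\<close>

lemma lsc_multi_at_strict_sublevel: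
  fixes g :: "'t::topological_space \<Rightarrow> 'x::topological_space \<Rightarrow> ereal"
  assumes lsc: "lsc_multi (\<lambda>t. epi (g t))" and h: "continuous_on UNIV h"
  shows "lsc_multi_at (\<lambda>t. {x. g t x < ereal (h t)}) t"
  unfolding lsc_multi_at_def
proof (intro allI impI)
  fix V assume V: "open V \<and> {x. g t x < ereal (h t)} \<inter> V \<noteq> {}"
  then obtain x where x: "x \<in> V" "g t x < ereal (h t)" by blast
  obtain \<beta> where \<beta>: "g t x < ereal \<beta>" "ereal \<beta> < ereal (h t)" using ereal_dense2[OF x(2)] by blast
  obtain \<alpha> where \<alpha>: "g t x < ereal \<alpha>" "ereal \<alpha> < ereal \<beta>" using ereal_dense2[OF \<beta>(1)] by blast
  have p: "(x, \<alpha>) \<in> epi (g t) \<inter> (V \<times> {..<\<beta>})" using \<alpha> x(1) by (auto simp: epi_def)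
  then have "lsc_multi_at (\<lambda>t. epi (g t)) t" using lsc unfolding lsc_multi_def by blast
  moreover have "open (V \<times> {..<\<beta>})" using V by (intro open_Times) auto
  moreover have "epi (g t) \<inter> (V \<times> {..<\<beta>}) \<noteq> {}" using p by blast
  ultimately obtain U where U: "open U" "t \<in> U" "\<And>s. s \<in> U \<Longrightarrow> epi (g s) \<inter> (V \<times> {..<\<beta>}) \<noteq> {}"
    unfolding lsc_multi_at_def by meson
  have "open (U \<inter> h -` {\<beta><..})" using U(1) h by (intro open_Int open_vimage) auto
  moreover have "t \<in> U \<inter> h -` {\<beta><..}" using U(2) \<beta>(2) by auto
  moreover have "{x. g s x < ereal (h s)} \<inter> V \<noteq> {}" if s: "s \<in> U \<inter> h -` {\<beta><..}" for s
  proof -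
    obtain y \<gamma> where "(y, \<gamma>) \<in> epi (g s)" "y \<in> V" "\<gamma> < \<beta>" using U(3)[of s] s by auto
    moreover from this have "g s y < ereal (h s)"
      using s by (auto simp: epi_def intro: le_less_trans)
    ultimately show ?thesis by blast
  qed
  ultimately show "\<exists>U. open U \<and> t \<in> U \<and> (\<forall>s\<in>U. {x. g s x < ereal (h s)} \<inter> V \<noteq> {})" by blast
qed

lemma convex_strict_sublevel:
  fixes g :: "'x::real_vector \<Rightarrow> ereal"
  assumes "convex (epi g)"
  shows "convex {x. g x < ereal c}"
proof (rule convexI)
  fix x y :: 'x and u v :: real
  assume "x \<in> {x. g x < ereal c}" "y \<in> {x. g x < ereal c}" and uv: "0 \<le> u" "0 \<le> v" "u + v = 1"
  then have "max (g x) (g y) < ereal c" by simp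
  then obtain \<alpha> where \<alpha>: "max (g x) (g y) < ereal \<alpha>" "ereal \<alpha> < ereal c" using ereal_dense2 by blast
  then have "(x, \<alpha>) \<in> epi g" "(y, \<alpha>) \<in> epi g" by (auto simp: epi_def)
  then have "u *\<^sub>R (x, \<alpha>) + v *\<^sub>R (y, \<alpha>) \<in> epi g" using convexD[OF assms] uv by blast
  moreover have "u * \<alpha> + v * \<alpha> = \<alpha>" using uv by (metis distrib_right mult_1)
  ultimately have "g (u *\<^sub>R x + v *\<^sub>R y) \<le> ereal \<alpha>" by (simp add: epi_def)
  then show "u *\<^sub>R x + v *\<^sub>R y \<in> {x. g x < ereal c}" using \<alpha>(2) le_less_trans by blast
qed

text \<open>Upper semicontinuity of the infimum: \<open>inf_fun g t < c\<close> says that a strict sublevel set is nonempty,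
and nonemptiness persists nearby for a lower semicontinuous multifunction.\<close>

lemma open_inf_fun_less:
  fixes g :: "'t::topological_space \<Rightarrow> 'x::topological_space \<Rightarrow> ereal"
  assumes lsc: "lsc_multi (\<lambda>t. epi (g t))"
  shows "open {t. inf_fun g t < ereal c}"
proof (rule topological_space_class.openI)
  fix t assume "t \<in> {t. inf_fun g t < ereal c}"
  then have "{x. g t x < ereal c} \<inter> UNIV \<noteq> {}" by (auto simp: inf_fun_def INF_less_iff)
  then obtain U where "open U" "t \<in> U" "\<And>s. s \<in> U \<Longrightarrow> {x. g s x < ereal c} \<inter> UNIV \<noteq> {}"
    using lsc_multi_at_strict_sublevel[OF lsc continuous_on_const[of UNIV c], of t]
    unfolding lsc_multi_at_def by (meson open_UNIV)
  then show "\<exists>T. open T \<and> t \<in> T \<and> T \<subseteq> {t. inf_fun g t < ereal c}"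
    by (intro exI[of _ U]) (auto simp: inf_fun_def INF_less_iff)
qed

text \<open>The strict inequality \<open>inf_fun f t < h t\<close> is what makes the sublevel sets below nonempty.  The
selection theorem yields points in their closures, and closedness of the epigraph turns
\<open>\<phi> t \<in> closure {x. f t x < h t}\<close> into the non-strict bound \<open>f t (\<phi> t) \<le> h t\<close>.\<close>

lemma selection_below_continuous_bound:
  fixes f :: "'t::metric_space \<Rightarrow> 'x::banach \<Rightarrow> ereal"
  assumes D: "countable D"
    and lsc: "lsc_multi (\<lambda>t. epi (f t))"
    and cl: "\<And>t. closed (epi (f t))" and cvx: "\<And>t. convex (epi (f t))"
    and h: "continuous_on UNIV h" "\<And>t. inf_fun f t < ereal (h t)"
  obtains \<phi> where "continuous_on UNIV \<phi>" "\<And>t. t \<in> closure D \<Longrightarrow> f t (\<phi> t) \<le> ereal (h t)"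
proof -
  let ?\<Phi> = "\<lambda>t. {x. f t x < ereal (h t)}"
  have "?\<Phi> t \<noteq> {}" for t using h(2)[of t] by (auto simp: inf_fun_def INF_less_iff)
  then obtain \<phi> where \<phi>: "continuous_on UNIV \<phi>" "\<And>t. t \<in> closure D \<Longrightarrow> \<phi> t \<in> closure (?\<Phi> t)"
    using michael_selection_separable[OF D, of ?\<Phi>] convex_strict_sublevel[OF cvx]
      lsc_multi_at_strict_sublevel[OF lsc h(1)] by blast
  have "f t (\<phi> t) \<le> ereal (h t)" if t: "t \<in> closure D" for t
  proof -
    have "closed ((\<lambda>x. (x, h t)) -` epi (f t))"
      by (intro closed_vimage cl continuous_intros)
    moreover have "?\<Phi> t \<subseteq> (\<lambda>x. (x, h t)) -` epi (f t)" by (auto simp: epi_def)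
    ultimately have "closure (?\<Phi> t) \<subseteq> (\<lambda>x. (x, h t)) -` epi (f t)" by (simp add: closure_minimal)
    then show ?thesis using \<phi>(2)[OF t] by (auto simp: epi_def)
  qed
  then show thesis using that \<phi>(1) by blast
qed

section \<open>Continuous approximation of an upper semicontinuous function\<close>

text \<open>The Lipschitz envelopes \<open>g n t = sup\<^sub>s (max (u s) (-n) - n * dist s t)\<close>: points \<open>s\<close> far from \<open>t\<close> are
penalised more and more, so that in the limit only the values of \<open>u\<close> near \<open>t\<close> count, and these are
controlled by upper semicontinuity.  Truncating at \<open>-n\<close> keeps the envelopes real-valued where \<open>u\<close>
is \<open>-\<infinity>\<close>.\<close>

lemma usc_nonpos_approx_from_above:
  fixes u :: "'t::metric_space \<Rightarrow> ereal"
  assumes usc: "\<And>c::real. open {t. u t < ereal c}" and nonpos: "\<And>t. u t \<le> 0"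
  obtains g :: "nat \<Rightarrow> 't \<Rightarrow> real"
  where "\<And>n. continuous_on UNIV (g n)" "\<And>n t. u t \<le> ereal (g n t)" "\<And>n t. g n t \<le> 0"
    "\<And>n t. g (Suc n) t \<le> g n t" "\<And>t. (\<lambda>n. ereal (g n t)) \<longlonglongrightarrow> u t"
proof -
  define q where "q n s = real_of_ereal (max (u s) (ereal (- real n)))" for n s
  have q: "ereal (q n s) = max (u s) (ereal (- real n))" for n s
  proof -
    have "max (u s) (ereal (- real n)) \<noteq> \<infinity>" "max (u s) (ereal (- real n)) \<noteq> - \<infinity>"
      using nonpos[of s] by (auto simp: max_def)
    then show ?thesis unfolding q_def
      by (cases "max (u s) (ereal (- real n))") auto
  qed
  have q_nonpos: "q n s \<le> 0" for n s
  proof -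
    have "ereal (q n s) \<le> 0" unfolding q using nonpos[of s] by (simp add: zero_ereal_def)
    then show ?thesis by (simp add: zero_ereal_def)
  qed
  have q_dec: "q (Suc n) s \<le> q n s" for n s
  proof -
    have "ereal (q (Suc n) s) \<le> ereal (q n s)" unfolding q by (intro max.mono) auto
    then show ?thesis by simp
  qed
  define g where "g n t = (SUP s. q n s - real n * dist s t)" for n t
  have le0: "q n s - real n * dist s t \<le> 0" for n s t
    using q_nonpos[of n s] mult_nonneg_nonneg[OF of_nat_0_le_iff zero_le_dist, of n s t] by linarith
  have bdd: "bdd_above (range (\<lambda>s. q n s - real n * dist s t))" for n t
    using le0 by (intro bdd_aboveI[of _ 0]) auto
  have up: "q n s - real n * dist s t \<le> g n t" for n s t
    unfolding g_def by (rule cSUP_upper[OF _ bdd]) simp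
  have least: "g n t \<le> c" if "\<And>s. q n s - real n * dist s t \<le> c" for n t c
    unfolding g_def using that by (intro cSUP_least) auto
  have g_nonpos: "g n t \<le> 0" for n t using le0 by (rule least)
  have g_ge: "u t \<le> ereal (g n t)" for n t
  proof -
    have "u t \<le> ereal (q n t)" unfolding q by simp
    also have "\<dots> \<le> ereal (g n t)" using up[of n t t] by simp
    finally show ?thesis .
  qed
  have g_dec: "g (Suc n) t \<le> g n t" for n t
  proof (rule least)
    fix s
    have "q (Suc n) s - real (Suc n) * dist s t \<le> q n s - real n * dist s t"
      using q_dec[of n s] by (simp add: algebra_simps add_increasing)
    also have "\<dots> \<le> g n t" by (rule up)
    finally show "q (Suc n) s - real (Suc n) * dist s t \<le> g n t" .
  qed
  have lip: "g n t \<le> g n t' + real n * dist t t'" for n t t'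
  proof (rule least)
    fix s
    have "real n * dist s t' \<le> real n * (dist s t + dist t t')"
      by (intro mult_left_mono dist_triangle) auto
    then show "q n s - real n * dist s t \<le> g n t' + real n * dist t t'"
      using up[of n s t'] by (simp add: algebra_simps)
  qed
  have g_cont: "continuous_on UNIV (g n)" for n
  proof (rule lipschitz_on_continuous_on)
    show "(real n)-lipschitz_on UNIV (g n)"
    proof (rule lipschitz_onI)
      fix t t' show "dist (g n t) (g n t') \<le> real n * dist t t'"
        using lip[of n t t'] lip[of n t' t] by (simp add: dist_real_def dist_commute abs_le_iff)
    qed simp
  qed
  have "(\<lambda>n. ereal (g n t)) \<longlonglongrightarrow> u t" for t
  proof (rule order_tendstoI)
    fix a assume "a < u t"
    then have "a < ereal (g n t)" for n using g_ge by (rule less_le_trans)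
    then show "\<forall>\<^sub>F n in sequentially. a < ereal (g n t)" by simp
  next
    fix a assume a: "u t < a"
    show "\<forall>\<^sub>F n in sequentially. ereal (g n t) < a"
    proof (cases "u t < 0")
      case False
      then have "0 < a" using a nonpos[of t] by auto
      moreover have "ereal (g n t) \<le> 0" for n using g_nonpos by (simp add: zero_ereal_def)
      ultimately have "ereal (g n t) < a" for n by (meson le_less_trans)
      then show ?thesis by simp
    next
      case True
      then have "u t < min a 0" using a by simp
      then obtain c where c: "u t < ereal c" "ereal c < min a 0" using ereal_dense2 by blast
      then obtain \<delta> where \<delta>: "\<delta> > 0" "ball t \<delta> \<subseteq> {t. u t < ereal c}"
        using usc[of c] open_contains_ball by (metis mem_Collect_eq)
      have "\<forall>\<^sub>F n in sequentially. - c \<le> real n"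
        using filterlim_real_sequentially unfolding filterlim_at_top by blast
      moreover have "\<forall>\<^sub>F n in sequentially. - c / \<delta> \<le> real n"
        using filterlim_real_sequentially unfolding filterlim_at_top by blast
      ultimately show ?thesis
      proof eventually_elim
        case (elim n)
        have "g n t \<le> c"
        proof (rule least)
          fix s
          show "q n s - real n * dist s t \<le> c"
          proof (cases "dist s t < \<delta>")
            case True
            then have "s \<in> ball t \<delta>" by (simp add: dist_commute)
            then have "u s < ereal c" using \<delta>(2) by blast
            then have "ereal (q n s) \<le> ereal c" unfolding q using elim(1) by simp
            then show ?thesis
              using mult_nonneg_nonneg[OF of_nat_0_le_iff zero_le_dist, of n s t]
              unfolding ereal_less_eq by linarith
          next
            case False
            have "- c \<le> real n * \<delta>" using mult_right_mono[OF elim(2), of \<delta>] \<delta>(1) by simp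
            also have "\<dots> \<le> real n * dist s t" using False by (intro mult_left_mono) auto
            finally show ?thesis using q_nonpos[of n s] by simp
          qed
        qed
        then show ?case using c(2) by (meson ereal_less_eq(3) le_less_trans min_less_iff_conj)
      qed
    qed
  qed
  then show thesis using that g_cont g_ge g_nonpos g_dec by blast
qed

text \<open>The envelopes \<open>g n\<close> of \<open>u = m - h\<close> may touch \<open>u\<close>, whereas the selection argument needs bounds
strictly above \<open>m\<close>.  Because \<open>u < 0\<close>, shrinking \<open>g n\<close> towards \<open>0\<close> by the factors
\<open>n / (n + 1)\<close> makes the inequality strict; the factors increase to \<open>1\<close>, which preserves both
monotonicity and the limit.\<close>

lemma usc_strict_approx_from_above:
  fixes m :: "'t::metric_space \<Rightarrow> ereal" and h :: "'t \<Rightarrow> real"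
  assumes usc: "\<And>c::real. open {t. m t < ereal c}"
    and h: "continuous_on UNIV h" "\<And>t. m t < ereal (h t)"
  obtains H :: "nat \<Rightarrow> 't \<Rightarrow> real"
  where "\<And>n. continuous_on UNIV (H n)" "\<And>n t. m t < ereal (H n t)" "\<And>n t. H n t \<le> h t"
    "\<And>n t. H (Suc n) t \<le> H n t" "\<And>t. (\<lambda>n. ereal (H n t)) \<longlonglongrightarrow> m t"
proof -
  define u where "u t = m t - ereal (h t)" for t
  have u_less: "u t < ereal c \<longleftrightarrow> m t < ereal (c + h t)" for t c
    unfolding u_def by (cases "m t") auto
  have m_u: "m t = ereal (h t) + u t" for t
    unfolding u_def by (cases "m t") auto
  have "open {t. u t < ereal c}" for c
  proof -
    have "{t. u t < ereal c} = (\<Union>r. {t. m t < ereal r} \<inter> {t. r < c + h t})"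
    proof (intro subset_antisym subsetI)
      fix t assume "t \<in> {t. u t < ereal c}"
      then have "m t < ereal (c + h t)" by (simp add: u_less)
      then obtain r where "m t < ereal r" "ereal r < ereal (c + h t)" using ereal_dense2 by blast
      then show "t \<in> (\<Union>r. {t. m t < ereal r} \<inter> {t. r < c + h t})" by auto
    next
      fix t assume "t \<in> (\<Union>r. {t. m t < ereal r} \<inter> {t. r < c + h t})"
      then show "t \<in> {t. u t < ereal c}" by (auto simp: u_less intro: less_trans)
    qed
    then show ?thesis
      by (simp only:) (intro open_UN ballI open_Int usc open_Collect_less continuous_intros h)
  qed
  moreover have neg: "u t < 0" for t using h(2)[of t] u_less[of t 0] by (simp add: zero_ereal_def)
  ultimately obtain g :: "nat \<Rightarrow> 't \<Rightarrow> real" where g: "\<And>n. continuous_on UNIV (g n)"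
      "\<And>n t. u t \<le> ereal (g n t)" "\<And>n t. g n t \<le> 0"
      "\<And>n t. g (Suc n) t \<le> g n t" "\<And>t. (\<lambda>n. ereal (g n t)) \<longlonglongrightarrow> u t"
    using usc_nonpos_approx_from_above[of u] by (metis less_imp_le)
  define \<theta> where "\<theta> n = real n / real (Suc n)" for n
  have \<theta>: "0 \<le> \<theta> n" "\<theta> n < 1" "\<theta> n \<le> \<theta> (Suc n)" for n by (auto simp: \<theta>_def field_simps)
  have \<theta>_lim: "\<theta> \<longlonglongrightarrow> 1" unfolding \<theta>_def by (rule LIMSEQ_n_over_Suc_n)
  define H where "H n t = h t + \<theta> n * g n t" for n t
  show thesis
  proof (rule that)
    show "continuous_on UNIV (H n)" for n unfolding H_def by (intro continuous_intros h g)
  next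
    fix n t
    have "u t < ereal (\<theta> n * g n t)"
    proof (cases "g n t = 0")
      case True then show ?thesis using neg by (simp add: zero_ereal_def)
    next
      case False
      then have "g n t < 0" using g(3)[of n t] by simp
      then have "g n t < \<theta> n * g n t" using \<theta>(2)[of n] by simp
      then show ?thesis using g(2)[of t n] by (meson le_less_trans less_ereal.simps(1))
    qed
    then show "m t < ereal (H n t)" by (simp add: u_less H_def add.commute)
  next
    fix n t
    show "H n t \<le> h t" using \<theta>(1)[of n] g(3)[of n t] by (simp add: H_def mult_nonneg_nonpos)
  next
    fix n t
    have "\<theta> (Suc n) * g (Suc n) t \<le> \<theta> (Suc n) * g n t" using \<theta>(1) g(4) by (simp add: mult_left_mono)
    also have "\<dots> \<le> \<theta> n * g n t" using \<theta>(3) g(3) by (simp add: mult_right_mono_neg)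
    finally show "H (Suc n) t \<le> H n t" by (simp add: H_def)
  next
    fix t
    have "(\<lambda>n. ereal (\<theta> n) * ereal (g n t)) \<longlonglongrightarrow> ereal 1 * u t"
      using \<theta>_lim g(5)[of t] by (intro tendsto_mult_ereal) auto
    then have "(\<lambda>n. ereal (h t) + ereal (\<theta> n) * ereal (g n t)) \<longlonglongrightarrow> ereal (h t) + u t"
      by (intro tendsto_add_ereal_general2) (auto simp: one_ereal_def[symmetric])
    then show "(\<lambda>n. ereal (H n t)) \<longlonglongrightarrow> m t" by (simp add: H_def m_u)
  qed
qed

section \<open>Monotonicity and convergence of upper integrals\<close>

lemma neg_min_zero_antimono: "x \<le> y \<Longrightarrow> - min y 0 \<le> - min x (0::ereal)"
  using min.mono[of x y 0 0] by (simp only: ereal_minus_le_minus order_refl)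

lemma upper_integral_mono_AE:
  assumes "AE t in M. g t \<le> h t"
  shows "upper_integral M g \<le> upper_integral M h"
  unfolding upper_integral_def
proof (intro add_mono)
  show "enn2ereal (\<integral>\<^sup>+ t. e2ennreal (max (g t) 0) \<partial>M) \<le> enn2ereal (\<integral>\<^sup>+ t. e2ennreal (max (h t) 0) \<partial>M)"
    unfolding less_eq_ennreal.rep_eq[symmetric]
    by (rule nn_integral_mono_AE) (use assms in \<open>auto elim!: eventually_mono intro!: e2ennreal_mono max.mono\<close>)
  have "(\<integral>\<^sup>+ t. e2ennreal (- min (h t) 0) \<partial>M) \<le> (\<integral>\<^sup>+ t. e2ennreal (- min (g t) 0) \<partial>M)"
    by (rule nn_integral_mono_AE)
      (use assms in \<open>auto elim!: eventually_mono intro!: e2ennreal_mono neg_min_zero_antimono simp del: ereal_minus_le_minus\<close>)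
  then show "- enn2ereal (\<integral>\<^sup>+ t. e2ennreal (- min (g t) 0) \<partial>M) \<le> - enn2ereal (\<integral>\<^sup>+ t. e2ennreal (- min (h t) 0) \<partial>M)"
    by (simp add: less_eq_ennreal.rep_eq)
qed

text \<open>The positive parts are dominated by the integrable function \<open>\<bar>h\<bar>\<close>, and the negative parts
increase.  The limit of the former is finite, so the two limits can be added even when the latter is
infinite.\<close>

lemma upper_integral_decreasing_limit:
  fixes H :: "nat \<Rightarrow> 't \<Rightarrow> real"
  assumes meas: "\<And>n. H n \<in> borel_measurable M"
    and dec: "\<And>n t. H (Suc n) t \<le> H n t"
    and dom: "integrable M h" "\<And>n t. H n t \<le> h t"
    and lim: "\<And>t. (\<lambda>n. ereal (H n t)) \<longlonglongrightarrow> m t"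
  shows "(\<lambda>n. upper_integral M (\<lambda>t. ereal (H n t))) \<longlonglongrightarrow> upper_integral M m"
proof -
  note [measurable] = meas
  have [measurable]: "m \<in> borel_measurable M"
    by (rule borel_measurable_LIMSEQ_order[where u="\<lambda>n t. ereal (H n t)"]) (use lim in auto)
  let ?P = "\<integral>\<^sup>+ t. e2ennreal (max (m t) 0) \<partial>M"
  have fin: "(\<integral>\<^sup>+ t. ennreal (norm (h t)) \<partial>M) < \<infinity>"
    using dom(1) by (simp add: integrable_iff_bounded)
  have dom': "e2ennreal (max (ereal (H n t)) 0) \<le> ennreal (norm (h t))" for n t
  proof -
    have "max (ereal (H n t)) 0 \<le> ereal (norm (h t))"
      using dom(2)[of n t] by (auto simp: zero_ereal_def)
    then show ?thesis unfolding ennreal_def[symmetric] by (metis e2ennreal_mono e2ennreal_ereal)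
  qed
  have P: "(\<lambda>n. \<integral>\<^sup>+ t. e2ennreal (max (ereal (H n t)) 0) \<partial>M) \<longlonglongrightarrow> ?P"
  proof (rule nn_integral_dominated_convergence[where w="\<lambda>t. ennreal (norm (h t))"])
    show "AE t in M. (\<lambda>n. e2ennreal (max (ereal (H n t)) 0)) \<longlonglongrightarrow> e2ennreal (max (m t) 0)"
      using lim by (intro AE_I2 tendsto_intros) auto
  qed (use dom(1) fin dom' in auto)
  have N: "(\<lambda>n. \<integral>\<^sup>+ t. e2ennreal (- min (ereal (H n t)) 0) \<partial>M) \<longlonglongrightarrow> (\<integral>\<^sup>+ t. e2ennreal (- min (m t) 0) \<partial>M)"
  proof (rule nn_integral_LIMSEQ)
    show "incseq (\<lambda>n t. e2ennreal (- min (ereal (H n t)) 0))"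
      unfolding incseq_Suc_iff le_fun_def
      by (intro allI e2ennreal_mono neg_min_zero_antimono) (simp add: dec)
    show "(\<lambda>n. e2ennreal (- min (ereal (H n t)) 0)) \<longlonglongrightarrow> e2ennreal (- min (m t) 0)" for t
      using lim by (intro tendsto_intros) auto
  qed measurable
  have "?P < \<infinity>"
  proof -
    have "?P \<le> (\<integral>\<^sup>+ t. ennreal (norm (h t)) \<partial>M)"
    proof (rule nn_integral_mono)
      fix t
      show "e2ennreal (max (m t) 0) \<le> ennreal (norm (h t))"
        using lim[of t] dom' by (intro LIMSEQ_le_const2[of "\<lambda>n. e2ennreal (max (ereal (H n t)) 0)"] tendsto_intros) auto
    qed
    then show ?thesis using fin by (rule le_less_trans)
  qed
  then have "\<bar>enn2ereal ?P\<bar> \<noteq> \<infinity>"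
    by (cases ?P) auto
  then show ?thesis
    unfolding upper_integral_def
    by (intro tendsto_add_ereal_general2 tendsto_intros P N)
qed

section \<open>Interchange of infimum and integral\<close>

theorem theorem3p4:
  fixes M :: "'t::metric_space measure"
    and f :: "'t \<Rightarrow> 'x::banach \<Rightarrow> ereal"
  assumes "space M = UNIV"
    and "complete_measure M"
    and "sigma_finite_measure M"
    and "sets borel \<subseteq> sets M"
    and "inner_regular_measure M"
    and "lsc_multi (\<lambda>t. epi (f t))"
    and "\<And>t. closed (epi (f t))"
    and "\<And>t. convex (epi (f t))"
    and "cont_integrable_above M (inf_fun f) \<noteq> {}"
  shows "(INF \<phi>\<in>{\<phi>. continuous_on UNIV \<phi>}. upper_integral M (\<lambda>t. f t (\<phi> t)))
           = upper_integral M (\<lambda>t. INF x. f t x)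
         \<and> upper_integral M (\<lambda>t. INF x. f t x) = upper_integral M (inf_fun f)"
proof
  have m_eq: "(\<lambda>t. INF x. f t x) = inf_fun f" by (intro ext) (simp add: inf_fun_def)
  show "upper_integral M (\<lambda>t. INF x. f t x) = upper_integral M (inf_fun f)" by (simp only: m_eq)
  obtain D where D: "countable D" "AE t in M. t \<in> closure D"
    using inner_regular_ae_separable[OF assms(1,3,4,5)] by blast
  obtain h where h: "continuous_on UNIV h" "integrable M h" "\<And>t. inf_fun f t < ereal (h t)"
    using assms(9) by (auto simp: cont_integrable_above_def)
  obtain H :: "nat \<Rightarrow> 't \<Rightarrow> real" where H: "\<And>n. continuous_on UNIV (H n)"
      "\<And>n t. inf_fun f t < ereal (H n t)" "\<And>n t. H n t \<le> h t"
      "\<And>n t. H (Suc n) t \<le> H n t" "\<And>t. (\<lambda>n. ereal (H n t)) \<longlonglongrightarrow> inf_fun f t"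
    using usc_strict_approx_from_above[OF open_inf_fun_less[OF assms(6)] h(1,3)] by blast
  have meas: "H n \<in> borel_measurable M" for n
  proof (rule measurableI)
    fix B :: "real set" assume "B \<in> sets borel"
    then have "H n -` B \<in> sets borel"
      using measurable_sets[OF borel_measurable_continuous_onI[OF H(1)[of n]]] by simp
    then show "H n -` B \<inter> space M \<in> sets M" using assms(1,4) by auto
  qed simp
  let ?I = "INF \<phi>\<in>{\<phi>. continuous_on UNIV \<phi>}. upper_integral M (\<lambda>t. f t (\<phi> t))"
  have "?I \<le> upper_integral M (\<lambda>t. ereal (H n t))" for n
  proof -
    obtain \<phi> where \<phi>: "continuous_on UNIV \<phi>" "\<And>t. t \<in> closure D \<Longrightarrow> f t (\<phi> t) \<le> ereal (H n t)"
      using selection_below_continuous_bound[OF D(1) assms(6-8) H(1,2)] by blast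
    have "?I \<le> upper_integral M (\<lambda>t. f t (\<phi> t))"
      using \<phi>(1) by (intro INF_lower) simp
    also have "\<dots> \<le> upper_integral M (\<lambda>t. ereal (H n t))"
      using D(2) \<phi>(2) by (intro upper_integral_mono_AE) (auto elim: eventually_mono)
    finally show ?thesis .
  qed
  then have "?I \<le> upper_integral M (inf_fun f)"
    using upper_integral_decreasing_limit[OF meas H(4) h(2) H(3,5)] by (intro LIMSEQ_le_const) auto
  moreover have "upper_integral M (inf_fun f) \<le> ?I"
    by (intro INF_greatest upper_integral_mono_AE AE_I2) (simp add: inf_fun_def INF_lower)
  ultimately show "?I = upper_integral M (\<lambda>t. INF x. f t x)"
    by (simp only: m_eq antisym)
qed

end
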